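(* Let $\Omega$ be a compact metric space and let $\mathcal{X}$ be a normed space of functions $\Omega\to\mathbb{R}$ satisfying hypotheses (H1) and (H1') (stated in the context). Let $\mathrm{L}:\mathcal{X}\to\mathcal{X}$ be a bounded linear operator of the form $$\mathrm{L}f(x)=\int_\Omega J(y)f(y)\,\mathrm{d}m_x(y)$$ for some positive function $J\in\mathcal{X}$ and some transition kernel $(m_x)_{x\in\Omega}$ (each $m_x$ being a probability measure on $\Omega$). Assume that $\mathrm{L}$ has positive eigendata $\lambda,h$, i.e. $\lambda>0$, $h\in\mathcal{X}$ is positive and bounded away from $0$, and $\mathrm{L}h=\lambda h$. Let $\delta\in(0,1)$. Then the following three properties are equivalent (with the same $\delta$, but possibly different constants $C$): (SG1) There is a closed subspace $G\subset\mathcal{X}$ with $\langle h\rangle\oplus G=\mathcal{X}$ and $\mathrm{L}(G)\subset G$, and a number $C>0$ such that $\lVert(\mathrm{L}|_G)^n\rVert\le C\lambda^n(1-\delta)^n$ for all $n\in\mathbb{N}$. (SG2) There exist continuous linear operators $\mathrm{P},\mathrm{R}:\mathcal{X}\to\mathcal{X}$ such that $\mathrm{L}=\lambda\mathrm{P}+\mathrm{R}$, $\mathrm{P}^2=\mathrm{P}$, $\dim\operatorname{Im}\mathrm{P}=1$, $\mathrm{P}\mathrm{R}=\mathrm{R}\mathrm{P}=0$, and a number $C>0$ such that $\lVert\mathrm{R}^n\rVert\le C\lambda^n(1-\delta)^n$ for all $n\in\mathbb{N}$, $n\ge 1$. (SG3) There is a Borel probability measure $\nu$ on $\Omega$ such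 that $\int\mathrm{L}(f)\,\mathrm{d}\nu=\lambda\int f\,\mathrm{d}\nu$ for all $f\in\mathcal{X}$, and a number $C>0$ such that for all $n\in\mathbb{N}$ and all $f\in\mathcal{X}$ with $\int f\,\mathrm{d}\nu=0$, $\lVert\mathrm{L}^n(f)\rVert\le C\lambda^n(1-\delta)^n\lVert f\rVert$.
   Context: Hypothesis (H1): $\mathcal{X}$, with its norm $\lVert\cdot\rVert$, is a Banach algebra of Borel-measurable, bounded functions $\Omega\to\mathbb{R}$ (with pointwise multiplication), which includes all constant functions, whose norm dominates the uniform norm (for some constant $A>0$, $\lVert f\rVert\ge A\lVert f\rVert_\infty$ for all $f\in\mathcal{X}$), and such that for every positive, bounded away from $0$ function $f\in\mathcal{X}$, the function $\log f$ also lies in $\mathcal{X}$. By (H1), every finite (signed) Borel measure $\mu$ on $\Omega$ defines a continuous linear form $f\mapsto\int f\,\mathrm{d}\mu$ on $\mathcal{X}$; this gives a natural map from finite measures (that is, $C^0(\Omega)^*$) to $\mathcal{X}^*$, which is not assumed to be injective. Hypothesis (H1'): if a finite (signed) Borel measure $\mu$ on $\Omega$ is such that $\int f\,\mathrm{d}\mu>0$ for all positive, bounded away from $0$ functions $f\in\mathcal{X}$, then $\mu$ is a positive measure; moreover the set of finite positive measures is closed in $\mathcal{X}^*$, i.e. its image under the natural map to $\mathcal{X}^*$ is closed for the dual norm. All spaces are over $\mathbb{R}$, and operator norms are those induced by $\lVert\cdot\rVert$. *)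

theory Defs
  imports "HOL-Probability.Probability"
begin

definition finite_signed_measure :: "('a::topological_space set \<Rightarrow> real) \<Rightarrow> bool" where
  "finite_signed_measure \<mu> \<longleftrightarrow> \<mu> {} = 0 \<and>
     (\<forall>A. range A \<subseteq> sets borel \<longrightarrow> disjoint_family A \<longrightarrow>
        (\<lambda>n::nat. \<mu> (A n)) sums \<mu> (\<Union>n. A n))"

text \<open>
  The upper variation of \<open>\<mu>\<close>, that is, the positive part of its Jordan decomposition;
  the negative part is the upper variation of \<open>-\<mu>\<close>.  Note that \<open>ennreal\<close>
  maps negative reals to \<open>0\<close>; this is harmless since \<open>B = {}\<close> competes in the supremum.
\<close>

definition upper_variation :: "('a::topological_space set \<Rightarrow> real) \<Rightarrow> 'a measure" where
  "upper_variation \<mu> =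
     measure_of UNIV (sets borel) (\<lambda>A. \<Squnion>B\<in>{B \<in> sets borel. B \<subseteq> A}. ennreal (\<mu> B))"

definition signed_integral ::
    "('a::topological_space set \<Rightarrow> real) \<Rightarrow> ('a \<Rightarrow> real) \<Rightarrow> real" where
  "signed_integral \<mu> f =
     (\<integral>x. f x \<partial>upper_variation \<mu>) - (\<integral>x. f x \<partial>upper_variation (\<lambda>A. - \<mu> A))"

definition finite_borel_measure :: "'a::topological_space measure \<Rightarrow> bool" where
  "finite_borel_measure M \<longleftrightarrow> finite_measure M \<and> sets M = sets borel"

lemma signed_integral_measure:
  assumes "finite_borel_measure M"
  shows "signed_integral (measure M) f = (\<integral>x. f x \<partial>M)"
proof -
  interpret finite_measure M using assms by (simp add: finite_borel_measure_def)
  have sM: "sets M = sets borel" using assms by (simp add: finite_borel_measure_def)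
  have spM: "space M = UNIV" using sets_eq_imp_space_eq[OF sM] by simp
  have sig: "sigma_sets UNIV (sets borel) = (sets borel :: 'a set set)"
    using sets.sigma_sets_eq[of "borel :: 'a measure"] by simp
  have "(\<Squnion>B\<in>{B \<in> sets borel. B \<subseteq> A}. ennreal (measure M B)) = emeasure M A"
    if "A \<in> sets borel" for A
    using that by (intro antisym SUP_least SUP_upper2[of A])
      (auto simp: emeasure_eq_measure sM intro!: ennreal_leI finite_measure_mono)
  then have "upper_variation (measure M) = measure_of UNIV (sets borel) (emeasure M)"
    unfolding upper_variation_def by (intro measure_of_eq) (auto simp: sig)
  also have "\<dots> = M" using measure_of_of_measure[of M] by (simp add: sM spM)
  finally have pos: "upper_variation (measure M) = M" .
  have "(\<Squnion>B\<in>{B \<in> sets borel. B \<subseteq> A}. ennreal (- measure M B)) = 0" for A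
    by (intro antisym SUP_least) (auto simp: ennreal_neg)
  then have "upper_variation (\<lambda>A. - measure M A) = null_measure borel"
    unfolding upper_variation_def null_measure_def by simp
  then show ?thesis unfolding signed_integral_def by (simp add: pos)
qed

definition pos_bounded_away :: "('a \<Rightarrow> real) \<Rightarrow> bool" where
  "pos_bounded_away f \<longleftrightarrow> (\<exists>c>0. \<forall>x. c \<le> f x)"

text \<open>
  The Banach algebra \<open>\<X>\<close> of functions is given by a type \<open>'x\<close> of its elements, carrying
  the norm, together with the map \<open>val\<close> reading an element as a function on \<open>\<Omega>\<close> (the universe
  of \<open>'a\<close>): \<open>\<X>\<close> is the range of \<open>val\<close>, which is injective and turns the vector space and algebra
  operations into the pointwise ones.  The class \<open>real_normed_algebra\<close> makes the norm
  submultiplicative without requiring that the constant function 1 have norm 1.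
\<close>

definition hyp_H1 ::
    "('x::{banach, real_normed_algebra} \<Rightarrow> 'a::metric_space \<Rightarrow> real) \<Rightarrow> bool" where
  "hyp_H1 val \<longleftrightarrow>
     inj val \<and>
     (\<forall>f g x. val (f + g) x = val f x + val g x) \<and>
     (\<forall>c f x. val (c *\<^sub>R f) x = c * val f x) \<and>
     (\<forall>f g x. val (f * g) x = val f x * val g x) \<and>
     (\<forall>f. val f \<in> borel_measurable borel \<and> bounded (range (val f))) \<and>
     (\<forall>c. (\<lambda>_. c) \<in> range val) \<and>
     (\<exists>A>0. \<forall>f. A * (\<Squnion>x. \<bar>val f x\<bar>) \<le> norm f) \<and>
     (\<forall>f. pos_bounded_away (val f) \<longrightarrow> (\<lambda>x. ln (val f x)) \<in> range val)"

definition hyp_H1' ::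
    "('x::{banach, real_normed_algebra} \<Rightarrow> 'a::metric_space \<Rightarrow> real) \<Rightarrow> bool" where
  "hyp_H1' val \<longleftrightarrow>
     (\<forall>\<mu>. finite_signed_measure \<mu> \<longrightarrow>
        (\<forall>f. pos_bounded_away (val f) \<longrightarrow> signed_integral \<mu> (val f) > 0) \<longrightarrow>
        (\<forall>A\<in>sets borel. \<mu> A \<ge> 0)) \<and>
     closed {\<phi> :: 'x \<Rightarrow>\<^sub>L real.
        \<exists>M. finite_borel_measure M \<and> (\<forall>f. blinfun_apply \<phi> f = (\<integral>x. val f x \<partial>M))}"

text \<open>Operator norm of the restriction to a subspace, compare \<open>onorm_def\<close>.\<close>

definition onorm_on ::
    "'x::real_normed_vector set \<Rightarrow> ('x \<Rightarrow> 'y::real_normed_vector) \<Rightarrow> real" where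
  "onorm_on G T = (\<Squnion>g\<in>G. norm (T g) / norm g)"

definition SG1 ::
    "('x::real_normed_vector \<Rightarrow> 'x) \<Rightarrow> real \<Rightarrow> 'x \<Rightarrow> real \<Rightarrow> bool" where
  "SG1 L lam h \<delta> \<longleftrightarrow>
     (\<exists>G. subspace G \<and> closed G \<and>
        span {h} \<inter> G = {0} \<and> {u + g |u g. u \<in> span {h} \<and> g \<in> G} = UNIV \<and>
        L ` G \<subseteq> G \<and>
        (\<exists>C>0. \<forall>n::nat. onorm_on G (L ^^ n) \<le> C * lam ^ n * (1 - \<delta>) ^ n))"

definition SG2 :: "('x::real_normed_vector \<Rightarrow> 'x) \<Rightarrow> real \<Rightarrow> real \<Rightarrow> bool" where
  "SG2 L lam \<delta> \<longleftrightarrow>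
     (\<exists>P R. bounded_linear P \<and> bounded_linear R \<and>
        L = (\<lambda>f. lam *\<^sub>R P f + R f) \<and> P \<circ> P = P \<and> dim (range P) = 1 \<and>
        P \<circ> R = (\<lambda>_. 0) \<and> R \<circ> P = (\<lambda>_. 0) \<and>
        (\<exists>C>0. \<forall>n::nat. n \<ge> 1 \<longrightarrow> onorm (R ^^ n) \<le> C * lam ^ n * (1 - \<delta>) ^ n))"

definition SG3 ::
    "('x::real_normed_vector \<Rightarrow> 'a::topological_space \<Rightarrow> real) \<Rightarrow> ('x \<Rightarrow> 'x) \<Rightarrow>
     real \<Rightarrow> real \<Rightarrow> bool" where
  "SG3 val L lam \<delta> \<longleftrightarrow>
     (\<exists>\<nu>. prob_space \<nu> \<and> sets \<nu> = sets borel \<and>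
        (\<forall>f. (\<integral>x. val (L f) x \<partial>\<nu>) = lam * (\<integral>x. val f x \<partial>\<nu>)) \<and>
        (\<exists>C>0. \<forall>(n::nat) f. (\<integral>x. val f x \<partial>\<nu>) = 0 \<longrightarrow>
           norm ((L ^^ n) f) \<le> C * lam ^ n * (1 - \<delta>) ^ n * norm f))"

end

theory Submission
  imports Defs
begin

text \<open>All three conditions express one fact: the eigenline of \<open>h\<close> is split off by
  a continuous functional \<open>\<phi>\<close> with \<open>\<phi> h = 1\<close> and
  \<open>\<phi> (L f) = lam * \<phi> f\<close>, on whose kernel the iterates of \<open>L\<close>
  decay like \<open>lam ^ n * (1 - \<delta>) ^ n\<close>. This is \<open>gap_functional\<close>, and
  each condition is compared with it separately.

  For \<open>SG1\<close> and \<open>SG2\<close> this is linear algebra with norms. A closed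
  invariant complement of the eigenline is the kernel of such a \<open>\<phi>\<close>
  (\<open>closed_hyperplane_functional\<close>). The projection of \<open>SG2\<close> must fix
  \<open>h\<close>, because the part of \<open>h\<close> in its kernel would be an eigenvector for
  \<open>lam\<close> in a space where \<open>L\<close> contracts faster; its range is then the
  eigenline and \<open>\<phi>\<close> is the coefficient.

  For \<open>SG3\<close> the functional has to come from a positive measure. Writing f as
  \<open>\<phi> f\<close> times \<open>h\<close> plus an element of the kernel shows that L^n f(x) /
  (lam^n h(x)) tends to \<open>\<phi> f\<close>, uniformly on the unit ball. Each approximant is
  integration against a positive measure, since the dual of \<open>L\<close> preserves positive
  measures (\<open>represented_transfer\<close>) and evaluation at x is a Dirac mass. Closedness of
  the positive measures in the dual passes this to the limit
  (\<open>represented_gap_functional\<close>), and normalising the mass gives the probability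
  measure.\<close>

section \<open>Coefficient functionals and operator norms on subspaces\<close>

text \<open>The functional is the coefficient along \<open>h\<close>, unique because
  \<open>h\<close> lies outside \<open>G\<close>. It is continuous because \<open>G\<close> is
  closed, so that \<open>h\<close> has positive distance from \<open>G\<close>; the inverse of this
  distance bounds its norm.\<close>

lemma closed_hyperplane_functional:
  fixes G :: "'x::real_normed_vector set" and h :: 'x
  assumes G: "subspace G" "closed G" and h: "h \<notin> G"
    and dec: "{u + g |u g. u \<in> span {h} \<and> g \<in> G} = UNIV"
  obtains \<phi> :: "'x \<Rightarrow> real" where "bounded_linear \<phi>" "\<phi> h = 1" "\<And>f. \<phi> f = 0 \<longleftrightarrow> f \<in> G"
proof -
  have ex: "\<exists>c. f - c *\<^sub>R h \<in> G" for f
  proof -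
    have "f \<in> {u + g |u g. u \<in> span {h} \<and> g \<in> G}"
      using dec by simp
    then obtain c g where "f = c *\<^sub>R h + g" "g \<in> G"
      by (auto simp: span_singleton)
    then have "f - c *\<^sub>R h \<in> G" by simp
    then show ?thesis ..
  qed
  have uniq: "c = d" if "f - c *\<^sub>R h \<in> G" "f - d *\<^sub>R h \<in> G" for f c d
  proof (rule ccontr)
    assume "c \<noteq> d"
    have "(f - c *\<^sub>R h) - (f - d *\<^sub>R h) \<in> G"
      by (rule subspace_diff[OF G(1) that])
    then have "(d - c) *\<^sub>R h \<in> G"
      by (simp add: scaleR_diff_left)
    from subspace_scale[OF G(1) this, of "inverse (d - c)"] show False
      using \<open>c \<noteq> d\<close> h by simp
  qed
  define \<phi> where "\<phi> f = (SOME c. f - c *\<^sub>R h \<in> G)" for f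
  have in_G: "f - \<phi> f *\<^sub>R h \<in> G" for f
    unfolding \<phi>_def by (rule someI_ex[OF ex])
  have eq: "\<phi> f = c" if "f - c *\<^sub>R h \<in> G" for f c
    using uniq[OF in_G that] .
  have "G \<noteq> {}" using subspace_0[OF G(1)] by auto
  then have d: "infdist h G > 0"
    using infdist_pos_not_in_closed[OF G(2) _ h] by simp
  have bound: "norm (\<phi> f) \<le> norm f * (1 / infdist h G)" for f
  proof (cases "\<phi> f = 0")
    case False
    \<comment> \<open>The distance from \<open>h\<close> to \<open>G\<close> is tested at a point of
      \<open>G\<close> that differs from \<open>h\<close> by \<open>f\<close> divided by
      \<open>\<phi> f\<close>.\<close>
    have "h - (1 / \<phi> f) *\<^sub>R f = (- 1 / \<phi> f) *\<^sub>R (f - \<phi> f *\<^sub>R h)"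
      using False by (simp add: algebra_simps)
    also have "\<dots> \<in> G" using in_G G(1) by (intro subspace_scale)
    finally have "infdist h G \<le> dist h (h - (1 / \<phi> f) *\<^sub>R f)"
      by (rule infdist_le)
    then have "infdist h G \<le> norm f / \<bar>\<phi> f\<bar>"
      by (simp add: dist_norm)
    then show ?thesis using d False by (simp add: field_simps)
  qed (use d in simp)
  have "bounded_linear \<phi>"
  proof (rule bounded_linear_intro[OF _ _ bound])
    fix f g :: 'x and r :: real
    have "(f - \<phi> f *\<^sub>R h) + (g - \<phi> g *\<^sub>R h) \<in> G"
      by (intro subspace_add G in_G)
    then show "\<phi> (f + g) = \<phi> f + \<phi> g"
      by (intro eq) (simp add: algebra_simps)
    have "r *\<^sub>R (f - \<phi> f *\<^sub>R h) \<in> G"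
      by (intro subspace_scale G in_G)
    then show "\<phi> (r *\<^sub>R f) = r *\<^sub>R \<phi> f"
      by (intro eq) (simp add: algebra_simps)
  qed
  moreover have "\<phi> h = 1"
    by (rule eq) (simp add: subspace_0[OF G(1)])
  moreover have "\<phi> f = 0 \<longleftrightarrow> f \<in> G" for f
    using in_G[of f] eq[of f 0] by auto
  ultimately show thesis by (rule that)
qed

lemma bounded_linear_funpow:
  "bounded_linear (T ^^ n)" if "bounded_linear T" for T :: "'x::real_normed_vector \<Rightarrow> 'x"
  using that by (induction n) (auto intro: bounded_linear_compose bounded_linear_ident simp: id_def o_def)

text \<open>A real supremum dominates its members only if they are bounded above; here the operator
  norm of \<open>T\<close> on the whole space is such a bound.\<close>

lemma onorm_on_bound:
  assumes "bounded_linear T" "g \<in> G"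
  shows "norm (T g) \<le> onorm_on G T * norm g"
proof (cases "g = 0")
  case True
  then show ?thesis using assms by (simp add: linear_simps)
next
  case False
  have "bdd_above ((\<lambda>g. norm (T g) / norm g) ` G)"
    using le_onorm[OF assms(1)] by (intro bdd_aboveI2)
  then have "norm (T g) / norm g \<le> onorm_on G T"
    unfolding onorm_on_def using assms(2) by (intro cSUP_upper)
  then show ?thesis using False by (simp add: field_simps)
qed

text \<open>Nonnegativity of \<open>b\<close> covers \<open>g = 0\<close>, where the quotient is 0
  by the convention for division by zero.\<close>

lemma onorm_on_le:
  assumes "G \<noteq> {}" "0 \<le> b" "\<And>g. g \<in> G \<Longrightarrow> norm (T g) \<le> b * norm g"
  shows "onorm_on G T \<le> b"
  unfolding onorm_on_def using assms
  by (intro cSUP_least) (auto simp: divide_le_eq)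

text \<open>
  All three gap conditions amount to the existence of such a \<open>\<phi>\<close>: its kernel is the complement
  in \<open>SG1\<close>, \<open>f \<mapsto> \<phi> f h\<close> is the projection in \<open>SG2\<close>, and \<open>\<phi>\<close> is integration
  against \<open>\<nu>\<close>, up to scaling, in \<open>SG3\<close>.
\<close>

definition gap_functional ::
    "('x::real_normed_vector \<Rightarrow> 'x) \<Rightarrow> real \<Rightarrow> 'x \<Rightarrow> real \<Rightarrow> ('x \<Rightarrow> real) \<Rightarrow> bool" where
  "gap_functional L lam h \<delta> \<phi> \<longleftrightarrow>
     bounded_linear \<phi> \<and> \<phi> h = 1 \<and> (\<forall>f. \<phi> (L f) = lam * \<phi> f) \<and>
     (\<exists>C>0. \<forall>(n::nat) f. \<phi> f = 0 \<longrightarrow>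
        norm ((L ^^ n) f) \<le> C * lam ^ n * (1 - \<delta>) ^ n * norm f)"

section \<open>Complements and projections as gap functionals\<close>

locale eigenpair =
  fixes L :: "'x::real_normed_vector \<Rightarrow> 'x" and lam \<delta> :: real and h :: 'x
  assumes L: "bounded_linear L" and lam: "lam > 0" and Lh: "L h = lam *\<^sub>R h" and h: "h \<noteq> 0"
    and \<delta>: "0 < \<delta>" "\<delta> < 1"
begin

lemma rate_nonneg: "0 \<le> lam ^ n * (1 - \<delta>) ^ n"
  using lam \<delta> by simp

lemma funpow_eigenvector: "(L ^^ n) (c *\<^sub>R h) = (c * lam ^ n) *\<^sub>R h"
  by (induction n) (auto simp: linear_simps[OF L] Lh)

lemma SG1_imp_gap_functional:
  assumes "SG1 L lam h \<delta>"
  shows "\<exists>\<phi>. gap_functional L lam h \<delta> \<phi>"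
proof -
  from assms obtain G C where G: "subspace G" "closed G" "span {h} \<inter> G = {0}"
      "{u + g |u g. u \<in> span {h} \<and> g \<in> G} = UNIV" "L ` G \<subseteq> G"
    and C: "C > 0" "\<forall>n. onorm_on G (L ^^ n) \<le> C * lam ^ n * (1 - \<delta>) ^ n"
    unfolding SG1_def by (elim exE conjE) (rule that)
  have "h \<notin> G" using G(3) h span_base[of h "{h}"] by blast
  then obtain \<phi> :: "'x \<Rightarrow> real"
    where \<phi>: "bounded_linear \<phi>" "\<phi> h = 1" and ker: "\<And>f. \<phi> f = 0 \<longleftrightarrow> f \<in> G"
    using closed_hyperplane_functional[OF G(1,2) _ G(4)] by blast
  have "\<phi> (L f) = lam * \<phi> f" for f
  proof -
    \<comment> \<open>Removing the component along \<open>h\<close> lands in \<open>G\<close>;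
      invariance of \<open>G\<close> keeps the image under \<open>L\<close> there, and expanding by
      linearity gives the eigenvalue relation.\<close>
    have "\<phi> (f - \<phi> f *\<^sub>R h) = 0" by (simp add: linear_simps[OF \<phi>(1)] \<phi>(2))
    then have "\<phi> (L (f - \<phi> f *\<^sub>R h)) = 0" using ker G(5) by blast
    then show ?thesis by (simp add: linear_simps[OF \<phi>(1)] linear_simps[OF L] \<phi>(2) Lh)
  qed
  moreover have "norm ((L ^^ n) f) \<le> C * lam ^ n * (1 - \<delta>) ^ n * norm f" if "\<phi> f = 0" for n f
  proof -
    have "norm ((L ^^ n) f) \<le> onorm_on G (L ^^ n) * norm f"
      using that ker by (intro onorm_on_bound bounded_linear_funpow L) simp
    also have "\<dots> \<le> C * lam ^ n * (1 - \<delta>) ^ n * norm f"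
      by (intro mult_right_mono C(2)[rule_format]) simp
    finally show ?thesis .
  qed
  ultimately show ?thesis
    unfolding gap_functional_def using \<phi> C(1) by blast
qed

lemma gap_functional_imp_SG1:
  assumes "gap_functional L lam h \<delta> \<phi>"
  shows "SG1 L lam h \<delta>"
proof -
  from assms obtain C where \<phi>: "bounded_linear \<phi>" "\<phi> h = 1" "\<And>f. \<phi> (L f) = lam * \<phi> f"
    and C: "C > 0"
      "\<And>n f. \<phi> f = 0 \<Longrightarrow> norm ((L ^^ n) f) \<le> C * lam ^ n * (1 - \<delta>) ^ n * norm f"
    unfolding gap_functional_def by blast
  note lin = linear_simps[OF \<phi>(1)]
  define G where "G = {f. \<phi> f = 0}"
  have "subspace G"
    unfolding G_def by (auto simp: subspace_def lin)
  moreover have "closed G"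
    unfolding G_def by (intro closed_Collect_eq continuous_intros
      linear_continuous_on \<phi>(1))
  moreover have "span {h} \<inter> G = {0}"
    unfolding G_def span_singleton by (auto simp: lin \<phi>(2))
  moreover have "{u + g |u g. u \<in> span {h} \<and> g \<in> G} = UNIV"
  proof -
    have "f = \<phi> f *\<^sub>R h + (f - \<phi> f *\<^sub>R h) \<and> \<phi> f *\<^sub>R h \<in> span {h} \<and> f - \<phi> f *\<^sub>R h \<in> G" for f
      unfolding G_def by (auto simp: lin \<phi>(2) span_singleton)
    then show ?thesis by blast
  qed
  moreover have "L ` G \<subseteq> G"
    unfolding G_def by (auto simp: \<phi>(3))
  moreover have "onorm_on G (L ^^ n) \<le> C * lam ^ n * (1 - \<delta>) ^ n" for n
  proof (rule onorm_on_le)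
    show "G \<noteq> {}" using \<open>subspace G\<close> subspace_0 by blast
    show "0 \<le> C * lam ^ n * (1 - \<delta>) ^ n"
      using rate_nonneg C(1) by (simp add: mult.assoc)
  qed (use C(2) in \<open>simp add: G_def\<close>)
  ultimately show ?thesis
    unfolding SG1_def using C(1) by blast
qed

lemma gap_functional_imp_SG2:
  assumes "gap_functional L lam h \<delta> \<phi>"
  shows "SG2 L lam \<delta>"
proof -
  from assms obtain C where \<phi>: "bounded_linear \<phi>" "\<phi> h = 1" "\<And>f. \<phi> (L f) = lam * \<phi> f"
    and C: "C > 0"
      "\<And>n f. \<phi> f = 0 \<Longrightarrow> norm ((L ^^ n) f) \<le> C * lam ^ n * (1 - \<delta>) ^ n * norm f"
    unfolding gap_functional_def by blast
  note lin = linear_simps[OF \<phi>(1)] linear_simps[OF L]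
  define P where "P f = \<phi> f *\<^sub>R h" for f
  define R where "R f = L f - lam *\<^sub>R P f" for f
  have P: "bounded_linear P"
    unfolding P_def by (rule bounded_linear_compose[OF bounded_linear_scaleR_left \<phi>(1)])
  have R: "bounded_linear R"
    unfolding R_def by (intro bounded_linear_sub L
      bounded_linear_compose[OF bounded_linear_scaleR_right P])
  have "range P = span {h}"
  proof -
    have "c *\<^sub>R h = P (c *\<^sub>R h)" for c
      by (simp add: P_def lin \<phi>(2))
    then have "c *\<^sub>R h \<in> range P" for c by (metis rangeI)
    then show ?thesis unfolding span_singleton P_def by blast
  qed
  then have dim: "dim (range P) = 1"
    using dim_eq_card_independent[of "{h}"] h by simp
  \<comment> \<open>The identity starts at \<open>n = 1\<close>: for \<open>n = 0\<close> the left
    side is \<open>f\<close>, the right side \<open>f - P f\<close>.\<close>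
  have pow: "(R ^^ n) f = (L ^^ n) (f - P f)" if "n \<ge> 1" for n f
    using that
  proof (induction n rule: dec_induct)
    case base
    then show ?case by (simp add: R_def P_def lin Lh)
  next
    case (step n)
    have ker: "\<phi> ((L ^^ n) g) = 0" if "\<phi> g = 0" for g
      by (induction n) (auto simp: \<phi>(3) that)
    \<comment> \<open>The iterates of \<open>f - P f\<close> stay in the kernel of
      \<open>\<phi>\<close>, where \<open>P\<close> vanishes and \<open>R\<close> acts as
      \<open>L\<close>.\<close>
    have "\<phi> (f - P f) = 0" by (simp add: P_def lin \<phi>(2))
    then show ?case using step ker by (simp add: R_def P_def[of "(L ^^ n) _"])
  qed
  \<comment> \<open>Decay is known only on the kernel, so \<open>f\<close> has to be projected
    there; \<open>K\<close> is the cost of this projection.\<close>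
  obtain K where K: "K > 0" "\<And>f. norm (f - P f) \<le> norm f * K"
    using bounded_linear.pos_bounded[OF bounded_linear_sub[OF bounded_linear_ident P]] by blast
  have "onorm (R ^^ n) \<le> C * K * lam ^ n * (1 - \<delta>) ^ n" if "n \<ge> 1" for n
  proof (rule onorm_bound)
    show "0 \<le> C * K * lam ^ n * (1 - \<delta>) ^ n"
      using rate_nonneg C(1) K(1) by (simp add: mult.assoc)
    fix f
    have "norm ((R ^^ n) f) \<le> C * lam ^ n * (1 - \<delta>) ^ n * norm (f - P f)"
      unfolding pow[OF that] by (rule C(2)) (simp add: P_def lin \<phi>(2))
    also have "\<dots> \<le> C * lam ^ n * (1 - \<delta>) ^ n * (norm f * K)"
      using rate_nonneg C(1) by (intro mult_left_mono K(2)) (simp add: mult.assoc)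
    finally show "norm ((R ^^ n) f) \<le> C * K * lam ^ n * (1 - \<delta>) ^ n * norm f"
      by (simp add: mult_ac)
  qed
  moreover have "P \<circ> P = P" "P \<circ> R = (\<lambda>_. 0)" "R \<circ> P = (\<lambda>_. 0)" "L = (\<lambda>f. lam *\<^sub>R P f + R f)"
    by (auto simp: fun_eq_iff R_def P_def lin \<phi>(2,3) Lh)
  moreover have "C * K > 0" using C K by simp
  ultimately show ?thesis
    unfolding SG2_def using P R dim by blast
qed

text \<open>On the kernel of \<open>P\<close> the iterates of \<open>L\<close> are those of
  \<open>R\<close>, which gives the decay. Once \<open>P h = h\<close> is known, the one-dimensional
  range of \<open>P\<close> is the line through \<open>h\<close>, and \<open>\<phi>\<close> is read
  off as the coefficient of \<open>P f\<close>.\<close>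

lemma SG2_imp_gap_functional:
  assumes "SG2 L lam \<delta>"
  shows "\<exists>\<phi>. gap_functional L lam h \<delta> \<phi>"
proof -
  from assms obtain P R C where P: "bounded_linear P" and R: "bounded_linear R"
    and LPR: "L = (\<lambda>f. lam *\<^sub>R P f + R f)" and "P \<circ> P = P" and dim: "dim (range P) = 1"
    and "P \<circ> R = (\<lambda>_. 0)" "R \<circ> P = (\<lambda>_. 0)"
    and C: "C > 0" "\<And>n. n \<ge> 1 \<Longrightarrow> onorm (R ^^ n) \<le> C * lam ^ n * (1 - \<delta>) ^ n"
    unfolding SG2_def by blast
  then have PP: "P (P f) = P f" and PR: "P (R f) = 0" and RP: "R (P f) = 0" for f
    by (auto simp: fun_eq_iff)
  note lin = linear_simps[OF P] linear_simps[OF R]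
  have PL: "P (L f) = lam *\<^sub>R P f" for f
    by (simp add: LPR lin PP PR)
  \<comment> \<open>Vanishing of \<open>P\<close> on the iterates is carried through the induction,
    since \<open>L\<close> and \<open>R\<close> agree only on that kernel.\<close>
  have pow: "(L ^^ n) f = (R ^^ n) f \<and> P ((L ^^ n) f) = 0" if "P f = 0" for n f
  proof (induction n)
    case (Suc n)
    have "L g = R g" if "P g = 0" for g
      using that by (simp add: LPR)
    with Suc show ?case using PL[of "(L ^^ n) f"] by (metis PR funpow.simps(2) o_apply)
  qed (simp add: that)
  have decay: "norm ((L ^^ n) f) \<le> C * lam ^ n * (1 - \<delta>) ^ n * norm f"
    if "P f = 0" "n \<ge> 1" for n f
  proof -
    have "norm ((L ^^ n) f) \<le> onorm (R ^^ n) * norm f"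
      using pow[OF that(1), of n] onorm[OF bounded_linear_funpow[OF R]] by simp
    also have "\<dots> \<le> C * lam ^ n * (1 - \<delta>) ^ n * norm f"
      by (intro mult_right_mono C that) simp
    finally show ?thesis .
  qed
  \<comment> \<open>\<open>h - P h\<close> is an eigenvector for \<open>lam\<close> on which \<open>L\<close> contracts faster than \<open>lam\<close>.\<close>
  have Ph: "P h = h"
  proof -
    define g where "g = h - P h"
    have "P g = 0" by (simp add: g_def lin PP)
    have "L g = lam *\<^sub>R g"
      using PL[of h] by (simp add: g_def linear_simps[OF L] Lh)
         (simp add: LPR PP RP scaleR_diff_right)
    then have "(L ^^ n) g = lam ^ n *\<^sub>R g" for n
      by (induction n) (auto simp: linear_simps[OF L] mult.commute)
    then have "lam ^ n * norm g \<le> lam ^ n * (C * (1 - \<delta>) ^ n * norm g)" if "n \<ge> 1" for n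
      using decay[OF \<open>P g = 0\<close> that] lam by (simp add: mult_ac)
    then have "norm g \<le> C * (1 - \<delta>) ^ n * norm g" if "n \<ge> 1" for n
      using that lam by (metis mult_le_cancel_left_pos zero_less_power)
    moreover have "(\<lambda>n. C * (1 - \<delta>) ^ n * norm g) \<longlonglongrightarrow> C * 0 * norm g"
      using \<delta> by (intro tendsto_intros LIMSEQ_power_zero) simp
    ultimately have "norm g \<le> C * 0 * norm g"
      by (intro LIMSEQ_le_const) auto
    then show ?thesis by (simp add: g_def)
  qed
  \<comment> \<open>The range is spanned by a single vector \<open>b\<close>; as
    \<open>h = P h\<close> is a nonzero multiple of \<open>b\<close>, it can take its place.\<close>
  have "\<exists>c. P f = c *\<^sub>R h" for f
  proof -
    obtain B where "range P \<subseteq> span B" "card B = 1"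
      using basis_exists[of "range P"] dim by metis
    then obtain b where "range P \<subseteq> span {b}"
      by (metis card_1_singletonE)
    then obtain s t where s: "P h = s *\<^sub>R b" and t: "P f = t *\<^sub>R b"
      unfolding span_singleton by blast
    have "s \<noteq> 0" using s Ph h by auto
    then have "P f = (t / s) *\<^sub>R h" using s t Ph by simp
    then show ?thesis ..
  qed
  then obtain \<phi> where \<phi>: "\<And>f. P f = \<phi> f *\<^sub>R h" by metis
  have "bounded_linear \<phi>"
  proof -
    obtain K where K: "\<And>f. norm (P f) \<le> norm f * K"
      using bounded_linear.bounded[OF P] by blast
    show ?thesis
    proof (rule bounded_linear_intro)
      fix f g :: 'x and r :: real
      have "\<phi> (f + g) *\<^sub>R h = (\<phi> f + \<phi> g) *\<^sub>R h"
        by (simp add: \<phi>[symmetric] lin scaleR_add_left)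
      then show "\<phi> (f + g) = \<phi> f + \<phi> g" using h by simp
      have "\<phi> (r *\<^sub>R f) *\<^sub>R h = (r * \<phi> f) *\<^sub>R h"
        using lin \<phi> by (metis scaleR_scaleR)
      then show "\<phi> (r *\<^sub>R f) = r *\<^sub>R \<phi> f" using h by simp
      show "norm (\<phi> f) \<le> norm f * (K / norm h)"
        using K[of f] h by (simp add: \<phi> field_simps)
    qed
  qed
  moreover have "\<phi> h = 1" using Ph \<phi>[of h] h by (metis scaleR_one scaleR_right_imp_eq)
  moreover have "\<phi> (L f) = lam * \<phi> f" for f
    using PL[of f] h by (simp add: \<phi>)
  \<comment> \<open>\<open>SG2\<close> bounds the powers only for \<open>n \<ge> 1\<close>, whereas
    a gap functional needs \<open>n = 0\<close> too, where the constant must be at least 1 unless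
    \<open>f = 0\<close>.\<close>
  moreover have "norm ((L ^^ n) f) \<le> max C 1 * lam ^ n * (1 - \<delta>) ^ n * norm f"
    if "\<phi> f = 0" for n f
  proof (cases "n = 0")
    case True
    then show ?thesis by (simp add: mult_le_cancel_right1)
  next
    case False
    then have "norm ((L ^^ n) f) \<le> C * lam ^ n * (1 - \<delta>) ^ n * norm f"
      using that by (intro decay) (simp_all add: \<phi>)
    also have "\<dots> \<le> max C 1 * lam ^ n * (1 - \<delta>) ^ n * norm f"
      using lam \<delta> by (intro mult_right_mono) auto
    finally show ?thesis .
  qed
  moreover have "max C 1 > 0" by simp
  ultimately show ?thesis
    unfolding gap_functional_def by blast
qed

end

section \<open>Evaluation and integration on the function algebra\<close>

locale measurable_function_algebra =
  fixes val :: "'x::{banach, real_normed_algebra} \<Rightarrow> 'a::metric_space \<Rightarrow> real"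
  assumes H1: "hyp_H1 val"
begin

lemma val_add: "val (f + g) x = val f x + val g x"
  and val_scaleR: "val (c *\<^sub>R f) x = c * val f x"
  and borel_measurable_val [measurable]: "val f \<in> borel_measurable borel"
  and bounded_val: "bounded (range (val f))"
  using H1 unfolding hyp_H1_def by simp_all

lemma val_zero: "val 0 x = 0"
  using val_scaleR[of 0 0 x] by simp

lemma val_bounded:
  obtains B where "\<And>x. \<bar>val f x\<bar> \<le> B"
  using bounded_val[of f] by (auto simp: bounded_iff)

lemma abs_val_le:
  obtains K where "K > 0" "\<And>f x. \<bar>val f x\<bar> \<le> norm f * K"
proof -
  obtain A where A: "A > 0" "\<And>f. A * (\<Squnion>x. \<bar>val f x\<bar>) \<le> norm f"
    using H1 unfolding hyp_H1_def by blast
  have "\<bar>val f x\<bar> \<le> norm f * (1 / A)" for f x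
  proof -
    \<comment> \<open>The supremum in \<open>hyp_H1\<close> is taken in the reals, so it bounds the
      single values only because each function is bounded.\<close>
    have "bdd_above (range (\<lambda>x. \<bar>val f x\<bar>))"
      using val_bounded[of f] by (metis bdd_aboveI2)
    then have "\<bar>val f x\<bar> \<le> (\<Squnion>x. \<bar>val f x\<bar>)"
      by (intro cSUP_upper) auto
    then have "A * \<bar>val f x\<bar> \<le> norm f"
      using A(1) A(2)[of f] by (meson mult_le_cancel_left_pos order_trans)
    then show ?thesis using A(1) by (simp add: field_simps)
  qed
  then show thesis using A(1) by (intro that[of "1 / A"]) auto
qed

lemma bounded_linear_val: "bounded_linear (\<lambda>f. val f x)"
proof -
  obtain K where "\<And>f x. \<bar>val f x\<bar> \<le> norm f * K" using abs_val_le by metis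
  then show ?thesis
    by (intro bounded_linear_intro[where K=K]) (auto simp: val_add val_scaleR)
qed

lemma integrable_val:
  assumes "finite_borel_measure M"
  shows "integrable M (val f)"
proof -
  interpret finite_measure M using assms by (simp add: finite_borel_measure_def)
  have [measurable_cong]: "sets M = sets borel"
    using assms by (simp add: finite_borel_measure_def)
  obtain B where "\<And>x. \<bar>val f x\<bar> \<le> B" using val_bounded[of f] by metis
  then show ?thesis by (intro integrable_const_bound[of _ B]) auto
qed

text \<open>Membership in the image of the finite positive measures in the dual, stated for plain
  functions so that it can be propagated without the type of bounded linear maps.\<close>

definition represented :: "('x \<Rightarrow> real) \<Rightarrow> bool" where
  "represented \<psi> \<longleftrightarrow> (\<exists>M. finite_borel_measure M \<and> (\<forall>f. \<psi> f = (\<integral>x. val f x \<partial>M)))"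

text \<open>The Dirac mass at \<open>x\<close> represents evaluation; it is the starting point for
  the iteration of the dual operator.\<close>

lemma represented_eval: "represented (\<lambda>f. val f x)"
proof -
  have "finite_borel_measure (return borel x)"
    by (simp add: finite_borel_measure_def prob_space.finite_measure prob_space_return)
  moreover have "val f x = (\<integral>y. val f y \<partial>return borel x)" for f
    by (simp add: integral_return)
  ultimately show ?thesis unfolding represented_def by blast
qed

lemma finite_borel_measure_density:
  assumes M: "finite_borel_measure M" and g: "g \<in> borel_measurable borel"
    "\<And>x. 0 \<le> g x" "\<And>x. g x \<le> B"
  shows "finite_borel_measure (density M (\<lambda>x. ennreal (g x)))"
proof -
  interpret finite_measure M using M by (simp add: finite_borel_measure_def)
  have sM [measurable_cong]: "sets M = sets borel"
    using M by (simp add: finite_borel_measure_def)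
  note g(1)[measurable]
  have "emeasure (density M (\<lambda>x. ennreal (g x))) (space M) = (\<integral>\<^sup>+x. ennreal (g x) \<partial>M)"
    by (subst emeasure_density) (auto intro!: nn_integral_cong)
  also have "\<dots> \<le> (\<integral>\<^sup>+x. ennreal B \<partial>M)"
    by (intro nn_integral_mono ennreal_leI g)
  also have "\<dots> < \<infinity>"
    by (simp add: ennreal_mult_less_top emeasure_eq_measure)
  finally show ?thesis
    unfolding finite_borel_measure_def using sM by (auto intro: finite_measureI)
qed

lemma integral_density_val:
  assumes M: "finite_borel_measure M" and g: "g \<in> borel_measurable borel" "\<And>x. 0 \<le> g x"
  shows "(\<integral>x. val f x \<partial>density M (\<lambda>x. ennreal (g x))) = (\<integral>x. g x * val f x \<partial>M)"
proof -
  have [measurable_cong]: "sets M = sets borel"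
    using M by (simp add: finite_borel_measure_def)
  note g(1)[measurable]
  show ?thesis by (subst integral_real_density) (use g(2) in auto)
qed

lemma represented_scale:
  assumes "represented \<psi>" "0 \<le> c"
  shows "represented (\<lambda>f. c * \<psi> f)"
proof -
  obtain M where M: "finite_borel_measure M" "\<And>f. \<psi> f = (\<integral>x. val f x \<partial>M)"
    using assms(1) unfolding represented_def by blast
  have "finite_borel_measure (density M (\<lambda>_. ennreal c))"
    using assms(2) by (intro finite_borel_measure_density M) auto
  moreover have "c * \<psi> f = (\<integral>x. val f x \<partial>density M (\<lambda>_. ennreal c))" for f
    using integral_density_val[OF M(1), of "\<lambda>_. c" f] assms(2) by (simp add: M(2))
  ultimately show ?thesis unfolding represented_def by blast
qed

text \<open>The dual of \<open>L\<close> preserves positive measures: if \<open>M\<close> represents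
  \<open>\<psi>\<close>, then averaging the kernel over \<open>M\<close> and weighting the result by
  \<open>J\<close> represents the composition of \<open>\<psi>\<close> with
  \<open>L\<close>.\<close>

lemma represented_transfer:
  assumes J: "\<And>y. val J y \<ge> 0" and m: "m \<in> borel \<rightarrow>\<^sub>M prob_algebra borel"
    and L: "\<And>f x. val (L f) x = (\<integral>y. val J y * val f y \<partial>m x)"
    and "represented \<psi>"
  shows "represented (\<lambda>f. \<psi> (L f))"
proof -
  obtain M where M: "finite_borel_measure M" "\<And>f. \<psi> f = (\<integral>x. val f x \<partial>M)"
    using assms(4) unfolding represented_def by blast
  interpret finite_measure M using M(1) by (simp add: finite_borel_measure_def)
  have sM [measurable_cong]: "sets M = sets borel"
    using M(1) by (simp add: finite_borel_measure_def)
  have spM: "space M = UNIV" using sets_eq_imp_space_eq[OF sM] by simp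
  have mM: "m \<in> M \<rightarrow>\<^sub>M subprob_algebra borel"
    using measurable_prob_algebraD[OF m] by simp
  have mx: "prob_space (m x)" "sets (m x) = sets borel" for x
    using measurable_space[OF m, of x] by (auto simp: space_prob_algebra)
  \<comment> \<open>The average of the measures \<open>m x\<close> over \<open>M\<close>. It has the
    same total mass as \<open>M\<close>, since each \<open>m x\<close> is a probability
    measure.\<close>
  define N where "N = M \<bind> m"
  have sN: "sets N = sets borel"
    unfolding N_def using mx(2) spM by (subst sets_bind) auto
  have "emeasure N UNIV = (\<integral>\<^sup>+x. emeasure (m x) UNIV \<partial>M)"
    unfolding N_def by (rule emeasure_bind[OF _ mM]) (auto simp: spM)
  also have "\<dots> = (\<integral>\<^sup>+x. 1 \<partial>M)"
  proof (rule nn_integral_cong)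
    fix x
    show "emeasure (m x) UNIV = 1"
      using prob_space.emeasure_space_1[OF mx(1)] sets_eq_imp_space_eq[OF mx(2)] by simp
  qed
  finally have N: "finite_borel_measure N"
    unfolding finite_borel_measure_def using sN sets_eq_imp_space_eq[OF sN]
    by (auto intro!: finite_measureI)
  obtain B where B: "\<And>x. \<bar>val J x\<bar> \<le> B" using val_bounded[of J] by metis
  have "finite_borel_measure (density N (\<lambda>y. ennreal (val J y)))"
    using B J by (intro finite_borel_measure_density[OF N]) (auto simp: abs_le_iff)
  moreover have "\<psi> (L f) = (\<integral>x. val f x \<partial>density N (\<lambda>y. ennreal (val J y)))" for f
  proof -
    obtain B' where B': "\<And>x. \<bar>val f x\<bar> \<le> B'" using val_bounded[of f] by metis
    have "\<psi> (L f) = (\<integral>x. \<integral>y. val J y * val f y \<partial>m x \<partial>M)"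
      by (simp add: M(2) L)
    also have "\<dots> = (\<integral>y. val J y * val f y \<partial>N)"
      unfolding N_def
    proof (rule integral_bind[OF _ _ mM, symmetric])
      \<comment> \<open>A bounded integrand and kernel measures of mass at most 1 justify writing
        the integral over \<open>N\<close> as an iterated integral.\<close>
      show "\<bar>val J y * val f y\<bar> \<le> B * B'" for y
        unfolding abs_mult using B B' by (intro mult_mono order_trans[OF abs_ge_zero B]) auto
      show "AE x in M. emeasure (m x) (space (m x)) \<le> ennreal 1"
        using prob_space.emeasure_space_1[OF mx(1)] by simp
    qed (auto intro: finite_measure_axioms)
    also have "\<dots> = (\<integral>x. val f x \<partial>density N (\<lambda>y. ennreal (val J y)))"
      using J by (intro integral_density_val[symmetric] N) auto
    finally show ?thesis .
  qed
  ultimately show ?thesis unfolding represented_def by blast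
qed

section \<open>Gap functionals and eigenmeasures\<close>

text \<open>
  The functional is the limit, in the dual norm, of
  \<open>f \<mapsto> L\<^sup>n f (x) / (\<lambda>\<^sup>n h (x))\<close> for any point \<open>x\<close>, and each of these is integration
  against a positive measure; this is where the closedness part of \<open>hyp_H1'\<close> enters.
\<close>

lemma represented_gap_functional:
  assumes closed: "hyp_H1' val"
    and J: "\<And>y. val J y \<ge> 0" and m: "m \<in> borel \<rightarrow>\<^sub>M prob_algebra borel"
    and "bounded_linear L" and kernel: "\<And>f x. val (L f) x = (\<integral>y. val J y * val f y \<partial>m x)"
    and h_pos: "pos_bounded_away (val h)" and eig: "eigenpair L lam \<delta> h"
    and gap: "gap_functional L lam h \<delta> \<phi>"
  shows "represented \<phi>"
proof -
  interpret eigenpair L lam \<delta> h by (rule eig)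
  obtain C where \<phi>: "bounded_linear \<phi>" "\<phi> h = 1" "\<And>f. \<phi> (L f) = lam * \<phi> f"
    and C: "C > 0"
      "\<And>n f. \<phi> f = 0 \<Longrightarrow> norm ((L ^^ n) f) \<le> C * lam ^ n * (1 - \<delta>) ^ n * norm f"
    using gap unfolding gap_functional_def by blast
  \<comment> \<open>Any point serves; types are nonempty, so \<open>undefined\<close> names
    one.\<close>
  define x :: 'a where "x = undefined"
  have hx: "val h x > 0"
    using h_pos unfolding pos_bounded_away_def by (meson order_less_le_trans)
  \<comment> \<open>The normalisation makes \<open>q n h = 1\<close>, in agreement with
    \<open>\<phi> h = 1\<close>.\<close>
  define q where "q n f = inverse (lam ^ n * val h x) * val ((L ^^ n) f) x" for n f
  have q_lin: "bounded_linear (q n)" for n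
    unfolding q_def using bounded_linear_compose[OF bounded_linear_val bounded_linear_funpow[OF L]]
    by (rule bounded_linear_const_mult)
  have iter: "represented (\<lambda>f. val ((L ^^ n) f) x)" for n
  proof (induction n)
    case (Suc n)
    \<comment> \<open>The transfer step inserts the new \<open>L\<close> innermost, while
      \<open>funpow\<close> puts it outermost; the two commute.\<close>
    from represented_transfer[OF J m kernel this] show ?case
      by (simp add: funpow_swap1)
  qed (simp add: represented_eval)
  have q_rep: "represented (q n)" for n
    unfolding q_def using lam hx by (intro represented_scale iter) simp
  obtain K where K: "K > 0" "\<And>f x. \<bar>val f x\<bar> \<le> norm f * K" using abs_val_le by metis
  have "bounded_linear (\<lambda>f. f - \<phi> f *\<^sub>R h)"
    by (intro bounded_linear_sub bounded_linear_ident
      bounded_linear_compose[OF bounded_linear_scaleR_left \<phi>(1)])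
  then obtain K' where K': "K' > 0" "\<And>f. norm (f - \<phi> f *\<^sub>R h) \<le> norm f * K'"
    using bounded_linear.pos_bounded by blast
  \<comment> \<open>The factors are the decay constant on the kernel, the bound for the projection
    to the kernel, the bound for point evaluation, and the normalisation by \<open>h\<close> at
    \<open>x\<close>.\<close>
  define D where "D = C * K' * K / val h x"
  have est: "norm (q n f - \<phi> f) \<le> D * (1 - \<delta>) ^ n * norm f" for n f
  proof -
    let ?g = "f - \<phi> f *\<^sub>R h"
    have "\<phi> ?g = 0" by (simp add: linear_simps[OF \<phi>(1)] \<phi>(2))
    \<comment> \<open>Since \<open>q n\<close> and \<open>\<phi>\<close> agree on multiples of
      \<open>h\<close>, the error is \<open>q n\<close> applied to the kernel component, where the
      decay is available.\<close>
    have "q n f - \<phi> f = q n f - q n (\<phi> f *\<^sub>R h)"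
      using lam hx by (simp add: q_def funpow_eigenvector val_scaleR field_simps)
    also have "\<dots> = q n ?g"
      by (simp add: linear_simps[OF q_lin])
    finally have "norm (q n f - \<phi> f) = inverse (lam ^ n * val h x) * \<bar>val ((L ^^ n) ?g) x\<bar>"
      using lam hx by (simp add: q_def abs_mult)
    moreover have "\<bar>val ((L ^^ n) ?g) x\<bar> \<le> C * lam ^ n * (1 - \<delta>) ^ n * (norm f * K') * K"
    proof -
      have "\<bar>val ((L ^^ n) ?g) x\<bar> \<le> norm ((L ^^ n) ?g) * K" by (rule K)
      also have "\<dots> \<le> C * lam ^ n * (1 - \<delta>) ^ n * norm ?g * K"
        using C(2)[OF \<open>\<phi> ?g = 0\<close>] K(1) by (intro mult_right_mono) auto
      also have "\<dots> \<le> C * lam ^ n * (1 - \<delta>) ^ n * (norm f * K') * K"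
        using lam \<delta> C(1) K(1) by (intro mult_right_mono mult_left_mono K') auto
      finally show ?thesis .
    qed
    ultimately have "norm (q n f - \<phi> f) \<le>
        inverse (lam ^ n * val h x) * (C * lam ^ n * (1 - \<delta>) ^ n * (norm f * K') * K)"
      using lam hx by (simp add: mult_left_mono)
    also have "\<dots> = D * (1 - \<delta>) ^ n * norm f"
      using lam hx by (simp add: D_def field_simps)
    finally show ?thesis .
  qed
  have D: "D \<ge> 0" unfolding D_def using C K K' hx by simp
  \<comment> \<open>This is the set whose closedness \<open>hyp_H1'\<close> asserts; the estimate
    \<open>est\<close> is uniform on the unit ball and so gives convergence in the dual
    norm.\<close>
  let ?S = "{\<psi> :: 'x \<Rightarrow>\<^sub>L real. represented (blinfun_apply \<psi>)}"
  have "closed ?S"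
    using closed unfolding hyp_H1'_def represented_def by blast
  moreover have "Blinfun (q n) \<in> ?S" for n
    using q_rep by (simp add: bounded_linear_Blinfun_apply[OF q_lin])
  moreover have "(\<lambda>n. Blinfun (q n)) \<longlonglongrightarrow> Blinfun \<phi>"
  proof (rule LIM_zero_cancel, rule Lim_null_comparison)
    show "\<forall>\<^sub>F n in sequentially. norm (Blinfun (q n) - Blinfun \<phi>) \<le> D * (1 - \<delta>) ^ n"
      using est D \<delta> by (intro always_eventually allI norm_blinfun_bound)
        (auto simp: blinfun.diff_left bounded_linear_Blinfun_apply[OF q_lin]
          bounded_linear_Blinfun_apply[OF \<phi>(1)])
    show "(\<lambda>n. D * (1 - \<delta>) ^ n) \<longlonglongrightarrow> 0"
      using \<delta> by (intro tendsto_mult_right_zero LIMSEQ_power_zero) simp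
  qed
  ultimately have "Blinfun \<phi> \<in> ?S"
    by (rule closed_sequentially)
  then show ?thesis by (simp add: bounded_linear_Blinfun_apply[OF \<phi>(1)])
qed

text \<open>Dividing the representing measure by its mass makes it a probability measure and changes
  neither the eigenvalue relation nor the kernel, so the constant \<open>C\<close> is kept.\<close>

lemma gap_functional_imp_SG3:
  assumes gap: "gap_functional L lam h \<delta> \<phi>" and "represented \<phi>"
  shows "SG3 val L lam \<delta>"
proof -
  obtain C where \<phi>: "\<phi> h = 1" "\<And>f. \<phi> (L f) = lam * \<phi> f"
    and C: "C > 0"
      "\<And>n f. \<phi> f = 0 \<Longrightarrow> norm ((L ^^ n) f) \<le> C * lam ^ n * (1 - \<delta>) ^ n * norm f"
    using gap unfolding gap_functional_def by blast
  obtain M where M: "finite_borel_measure M" "\<And>f. \<phi> f = (\<integral>x. val f x \<partial>M)"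
    using assms(2) unfolding represented_def by blast
  interpret finite_measure M using M(1) by (simp add: finite_borel_measure_def)
  have sM: "sets M = sets borel"
    using M(1) by (simp add: finite_borel_measure_def)
  define c where "c = measure M (space M)"
  \<comment> \<open>A measure of mass zero would integrate \<open>h\<close> to 0, against
    \<open>\<phi> h = 1\<close>.\<close>
  have "c \<noteq> 0"
  proof
    assume "c = 0"
    then have "emeasure M (space M) = 0" by (simp add: c_def emeasure_eq_measure)
    then have "AE x in M. val h x = 0" by (intro AE_I[of _ _ "space M"]) auto
    then have "\<phi> h = 0" by (simp add: M(2) integral_eq_zero_AE)
    with \<phi>(1) show False by simp
  qed
  then have c: "c > 0" by (simp add: c_def less_le)
  define \<nu> where "\<nu> = density M (\<lambda>_. ennreal (1 / c))"
  have "emeasure \<nu> (space \<nu>) = ennreal (1 / c) * emeasure M (space M)"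
    unfolding \<nu>_def by (simp add: emeasure_density nn_integral_cmult)
  also have "\<dots> = 1"
    using c by (simp add: emeasure_eq_measure c_def[symmetric] ennreal_mult[symmetric])
  finally have "prob_space \<nu>" by (rule prob_spaceI)
  moreover have "sets \<nu> = sets borel" by (simp add: \<nu>_def sM)
  moreover have int: "(\<integral>x. val f x \<partial>\<nu>) = \<phi> f / c" for f
    unfolding \<nu>_def using integral_density_val[OF M(1), of "\<lambda>_. 1 / c" f] c by (simp add: M(2))
  moreover have "(\<integral>x. val (L f) x \<partial>\<nu>) = lam * (\<integral>x. val f x \<partial>\<nu>)" for f
    by (simp add: int \<phi>(2))
  moreover have "norm ((L ^^ n) f) \<le> C * lam ^ n * (1 - \<delta>) ^ n * norm f"
    if "(\<integral>x. val f x \<partial>\<nu>) = 0" for n f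
    using that c by (intro C(2)) (simp add: int)
  ultimately show ?thesis
    unfolding SG3_def using C(1) by blast
qed

text \<open>Integration against \<open>\<nu>\<close> is continuous because the norm dominates the
  uniform norm; dividing by the integral of \<open>h\<close> normalises it at
  \<open>h\<close>.\<close>

lemma SG3_imp_gap_functional:
  assumes "SG3 val L lam \<delta>" and h: "pos_bounded_away (val h)"
  shows "\<exists>\<phi>. gap_functional L lam h \<delta> \<phi>"
proof -
  obtain \<nu> C where \<nu>: "prob_space \<nu>" "sets \<nu> = sets borel"
      "\<And>f. (\<integral>x. val (L f) x \<partial>\<nu>) = lam * (\<integral>x. val f x \<partial>\<nu>)"
    and C: "C > 0" "\<And>n f. (\<integral>x. val f x \<partial>\<nu>) = 0 \<Longrightarrow>
           norm ((L ^^ n) f) \<le> C * lam ^ n * (1 - \<delta>) ^ n * norm f"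
    using assms(1) unfolding SG3_def by blast
  interpret prob_space \<nu> by (rule \<nu>(1))
  have "finite_borel_measure \<nu>"
    by (simp add: finite_borel_measure_def finite_measure_axioms \<nu>(2))
  note int = integrable_val[OF this]
  obtain c where c: "c > 0" "\<And>x. c \<le> val h x"
    using h unfolding pos_bounded_away_def by blast
  define b where "b = (\<integral>x. val h x \<partial>\<nu>)"
  \<comment> \<open>Here \<open>h\<close> being bounded away from 0 enters: its integral against a
    probability measure is at least the lower bound \<open>c\<close>.\<close>
  have "c \<le> b" unfolding b_def using c by (intro integral_ge_const int) auto
  then have b: "b > 0" using c(1) by simp
  define \<phi> where "\<phi> f = (\<integral>x. val f x \<partial>\<nu>) / b" for f
  obtain K where K: "K > 0" "\<And>f x. \<bar>val f x\<bar> \<le> norm f * K" using abs_val_le by metis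
  have "bounded_linear \<phi>"
  proof (rule bounded_linear_intro)
    fix f g :: 'x and r :: real
    show "\<phi> (f + g) = \<phi> f + \<phi> g"
      by (simp add: \<phi>_def val_add int add_divide_distrib)
    show "\<phi> (r *\<^sub>R f) = r *\<^sub>R \<phi> f"
      by (simp add: \<phi>_def val_scaleR)
    have "\<bar>\<integral>x. val f x \<partial>\<nu>\<bar> \<le> (\<integral>x. \<bar>val f x\<bar> \<partial>\<nu>)"
      by (rule integral_abs_bound)
    also have "\<dots> \<le> norm f * K"
      using K(2) by (intro integral_le_const integrable_abs int) auto
    finally show "norm (\<phi> f) \<le> norm f * (K / b)"
      using b by (simp add: \<phi>_def field_simps)
  qed
  moreover have "\<phi> h = 1" using b by (simp add: \<phi>_def b_def)
  moreover have "\<phi> (L f) = lam * \<phi> f" for f by (simp add: \<phi>_def \<nu>(3))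
  moreover have "norm ((L ^^ n) f) \<le> C * lam ^ n * (1 - \<delta>) ^ n * norm f" if "\<phi> f = 0" for n f
    using that b by (intro C(2)) (simp add: \<phi>_def)
  ultimately show ?thesis
    unfolding gap_functional_def using C(1) by blast
qed

end

theorem theorem5p1:
  fixes val :: "'x::{banach, real_normed_algebra} \<Rightarrow> 'a::metric_space \<Rightarrow> real"
    and L :: "'x \<Rightarrow> 'x" and J h :: 'x and m :: "'a \<Rightarrow> 'a measure" and lam \<delta> :: real
  assumes "compact (UNIV :: 'a set)"
    and "hyp_H1 val" and "hyp_H1' val"
    and "bounded_linear L"
    and "\<And>y. val J y > 0"
    and "m \<in> borel \<rightarrow>\<^sub>M prob_algebra borel"
    and "\<And>f x. val (L f) x = (\<integral>y. val J y * val f y \<partial>m x)"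
    and "lam > 0" and "pos_bounded_away (val h)" and "L h = lam *\<^sub>R h"
    and "0 < \<delta>" and "\<delta> < 1"
  shows "(SG1 L lam h \<delta> \<longleftrightarrow> SG2 L lam \<delta>) \<and> (SG2 L lam \<delta> \<longleftrightarrow> SG3 val L lam \<delta>)"
proof -
  interpret measurable_function_algebra val
    using assms(2) by unfold_locales
  have "h \<noteq> 0"
    using assms(9) unfolding pos_bounded_away_def by (metis val_zero not_less)
  then interpret eigenpair L lam \<delta> h
    using assms by (intro eigenpair.intro)
  \<comment> \<open>This is the link to \<open>SG3\<close>: gap functionals obtained from
    \<open>SG1\<close> or \<open>SG2\<close> are integrals against positive measures.\<close>
  have "represented \<phi>" if "gap_functional L lam h \<delta> \<phi>" for \<phi>
    by (rule represented_gap_functional[OF assms(3) less_imp_le[OF assms(5)] assms(6,4,7,9)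
      eigenpair_axioms that])
  then show ?thesis
    using SG1_imp_gap_functional gap_functional_imp_SG1 SG2_imp_gap_functional
      gap_functional_imp_SG2 SG3_imp_gap_functional[OF _ assms(9)] gap_functional_imp_SG3
    by blast
qed

end
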